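(* Let $\pi=(\pi_{ij})$ be a strictly positive probability distribution on $\{1,\dots,I_1\}\times\{1,\dots,I_2\}$, $I_1,I_2\ge2$. If the $F$-scaled interactions of type $LC$, $\gamma_{ij}(F;L,C)$, are non negative for all $i<I_1$, $j<I_2$, then the log-odds ratios of type $LG$ and those of type $GG$ are all non negative.
   Context: $\phi$ is a real-valued convex function on $[0,\infty)$, differentiable on $(0,\infty)$, with $\phi(1)=\phi'(1)=0$, and $F=\phi'$ is strictly increasing on $(0,\infty)$ (so it has an inverse). Write $\pi_{i+}=\sum_j\pi_{ij}$ and $\pi_{+j}=\sum_i\pi_{ij}$. For type $LC$ (local logits for rows, continuation logits for columns), for $i\le I_1$, $j<I_2$ put $p(i,j,0)=\pi_{ij}$, $p(i,j,1)=\sum_{h>j}\pi_{ih}$, $p(+,j,v)=\sum_{i=1}^{I_1}p(i,j,v)$. The $F$-scaled interactions of type $LC$ are, for $i<I_1$, $j<I_2$, $$\gamma_{ij}(F;L,C)=F\!\left[\tfrac{p(i+1,j,1)}{\pi_{i+1,+}p(+,j,1)}\right]-F\!\left[\tfrac{p(i+1,j,0)}{\pi_{i+1,+}p(+,j,0)}\right]-F\!\left[\tfrac{p(i,j,1)}{\pi_{i+}p(+,j,1)}\right]+F\!\left[\tfrac{p(i,j,0)}{\pi_{i+}p(+,j,0)}\right].$$ Log-odds ratios of type $LG$ (local for rows, global for columns): for $i<I_1$, $j<I_2$, $$\eta_{LG}(i,j)=\log\frac{\big(\sum_{h>j}\pi_{i+1,h}\big)\big(\sum_{h\le j}\pi_{ih}\big)}{\big(\sum_{h>j}\pi_{ih}\big)\big(\sum_{h\le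 j}\pi_{i+1,h}\big)}.$$ Log-odds ratios of type $GG$ (global for both): for $i<I_1$, $j<I_2$, $$\eta_{GG}(i,j)=\log\frac{\big(\sum_{g>i,\,h>j}\pi_{gh}\big)\big(\sum_{g\le i,\,h\le j}\pi_{gh}\big)}{\big(\sum_{g\le i,\,h>j}\pi_{gh}\big)\big(\sum_{g>i,\,h\le j}\pi_{gh}\big)}.$$ *)

theory Defs
  imports "HOL-Analysis.Analysis"
begin

text \<open>
  A table on {1..I1} x {1..I2} is a function of type \<^typ>\<open>nat \<Rightarrow> nat \<Rightarrow> real\<close>, with 1-based
  indices; its values outside this range are irrelevant and never used.
\<close>

definition row_marg :: "nat \<Rightarrow> (nat \<Rightarrow> nat \<Rightarrow> real) \<Rightarrow> nat \<Rightarrow> real" where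
  "row_marg I2 \<pi> i = (\<Sum>j\<in>{1..I2}. \<pi> i j)"

text \<open>The last argument \<open>v\<close> is meant to be 0 or 1.\<close>

definition p_LC :: "nat \<Rightarrow> (nat \<Rightarrow> nat \<Rightarrow> real) \<Rightarrow> nat \<Rightarrow> nat \<Rightarrow> nat \<Rightarrow> real" where
  "p_LC I2 \<pi> i j v = (if v = 0 then \<pi> i j else (\<Sum>h\<in>{j<..I2}. \<pi> i h))"

definition p_LC_plus ::
  "nat \<Rightarrow> nat \<Rightarrow> (nat \<Rightarrow> nat \<Rightarrow> real) \<Rightarrow> nat \<Rightarrow> nat \<Rightarrow> real" where
  "p_LC_plus I1 I2 \<pi> j v = (\<Sum>i\<in>{1..I1}. p_LC I2 \<pi> i j v)"

definition gamma_LC ::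
  "(real \<Rightarrow> real) \<Rightarrow> nat \<Rightarrow> nat \<Rightarrow> (nat \<Rightarrow> nat \<Rightarrow> real) \<Rightarrow> nat \<Rightarrow> nat \<Rightarrow> real" where
  "gamma_LC F I1 I2 \<pi> i j =
     F (p_LC I2 \<pi> (i + 1) j 1 / (row_marg I2 \<pi> (i + 1) * p_LC_plus I1 I2 \<pi> j 1))
   - F (p_LC I2 \<pi> (i + 1) j 0 / (row_marg I2 \<pi> (i + 1) * p_LC_plus I1 I2 \<pi> j 0))
   - F (p_LC I2 \<pi> i j 1 / (row_marg I2 \<pi> i * p_LC_plus I1 I2 \<pi> j 1))
   + F (p_LC I2 \<pi> i j 0 / (row_marg I2 \<pi> i * p_LC_plus I1 I2 \<pi> j 0))"

definition eta_LG :: "nat \<Rightarrow> (nat \<Rightarrow> nat \<Rightarrow> real) \<Rightarrow> nat \<Rightarrow> nat \<Rightarrow> real" where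
  "eta_LG I2 \<pi> i j =
     ln (((\<Sum>h\<in>{j<..I2}. \<pi> (i + 1) h) * (\<Sum>h\<in>{1..j}. \<pi> i h))
       / ((\<Sum>h\<in>{j<..I2}. \<pi> i h) * (\<Sum>h\<in>{1..j}. \<pi> (i + 1) h)))"

definition eta_GG :: "nat \<Rightarrow> nat \<Rightarrow> (nat \<Rightarrow> nat \<Rightarrow> real) \<Rightarrow> nat \<Rightarrow> nat \<Rightarrow> real" where
  "eta_GG I1 I2 \<pi> i j =
     ln (((\<Sum>g\<in>{i<..I1}. \<Sum>h\<in>{j<..I2}. \<pi> g h) * (\<Sum>g\<in>{1..i}. \<Sum>h\<in>{1..j}. \<pi> g h))
       / ((\<Sum>g\<in>{1..i}. \<Sum>h\<in>{j<..I2}. \<pi> g h) * (\<Sum>g\<in>{i<..I1}. \<Sum>h\<in>{1..j}. \<pi> g h)))"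

end

theory Submission imports Defs begin

text \<open>
  Write \<open>T\<^sub>j(i)\<close> for the conditional probability of \<open>{h. h > j}\<close> given row \<open>i\<close>. Non-negativity of
  the \<open>LG\<close> log-odds ratios means that \<open>T\<^sub>j(i) \<le> T\<^sub>j(i + 1)\<close>, that is, the rows are stochastically
  increasing. This follows by induction on \<open>j\<close> from \<open>T\<^sub>0(i) = 1\<close>: if \<open>T\<^sub>j\<close> decreases from row \<open>i\<close> to row
  \<open>i + 1\<close> although \<open>T\<^bsub>j-1\<^esub>\<close> does not, then the conditional probability of column \<open>j\<close>
  increases, and by monotonicity of \<open>F\<close> the interaction at \<open>(i, j)\<close> is negative. The \<open>GG\<close>
  ratios compare mixtures of the rows up to \<open>i\<close> with mixtures of the rows beyond \<open>i\<close>, so they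
  are non-negative as well.
\<close>

lemma sum_atMost_plus_greaterThan:
  fixes f :: "nat \<Rightarrow> 'a::comm_monoid_add"
  assumes "j \<le> n"
  shows "(\<Sum>h\<in>{1..j}. f h) + (\<Sum>h\<in>{j<..n}. f h) = (\<Sum>h\<in>{1..n}. f h)"
proof -
  have "{1..n} = {1..j} \<union> {j<..n}"
    using assms by auto
  moreover have "{1..j} \<inter> {j<..n} = {}"
    by auto
  ultimately show ?thesis
    by (metis sum.union_disjoint finite_atLeastAtMost finite_greaterThanAtMost)
qed

lemma sum_greaterThan_head:
  fixes f :: "nat \<Rightarrow> 'a::comm_monoid_add"
  assumes "j < n"
  shows "(\<Sum>h\<in>{j<..n}. f h) = f (Suc j) + (\<Sum>h\<in>{Suc j<..n}. f h)"
proof -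
  have "{j<..n} = insert (Suc j) {Suc j<..n}"
    using assms by auto
  then show ?thesis
    by simp
qed

text \<open>Clearing denominators leaves \<open>t * t'\<close> on both sides, where it cancels. This
  turns tail probabilities into the cross products inside the log-odds ratios.\<close>

lemma odds_le_iff:
  fixes t t' h h' :: real
  assumes "t + h > 0" "t' + h' > 0"
  shows "t / (t + h) \<le> t' / (t' + h') \<longleftrightarrow> t * h' \<le> t' * h"
  using assms by (simp add: divide_simps algebra_simps)

lemma ln_divide_nonneg:
  fixes x y :: real
  assumes "0 < y" "y \<le> x"
  shows "ln (x / y) \<ge> 0"
  using assms by simp

lemma conditional_tail_mono_step:
  fixes F :: "real \<Rightarrow> real"
  assumes strict: "strict_mono_on {0<..} F"
    and pos: "\<And>i j. i \<in> {1..I1} \<Longrightarrow> j \<in> {1..I2} \<Longrightarrow> \<pi> i j > 0"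
    and i: "i \<in> {1..<I1}"
    and gamma: "\<And>j. j \<in> {1..<I2} \<Longrightarrow> gamma_LC F I1 I2 \<pi> i j \<ge> 0"
  shows "j < I2 \<Longrightarrow> (\<Sum>h\<in>{j<..I2}. \<pi> i h) / row_marg I2 \<pi> i
           \<le> (\<Sum>h\<in>{j<..I2}. \<pi> (Suc i) h) / row_marg I2 \<pi> (Suc i)"
proof (induction j)
  \<comment> \<open>Columns start at 1, so the tail beyond 0 is the whole row and both quotients
    equal 1.\<close>
  case 0
  have tail: "(\<Sum>h\<in>{0<..I2}. \<pi> k h) = row_marg I2 \<pi> k" for k
    unfolding row_marg_def by (rule sum.cong) auto
  have "row_marg I2 \<pi> k > 0" if "k \<in> {1..I1}" for k
    unfolding row_marg_def using that pos 0 by (intro sum_pos) auto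
  from this[of i] this[of "Suc i"] show ?case
    using i unfolding tail by simp
next
  case (Suc j)
  define t where "t k l = (\<Sum>h\<in>{l<..I2}. \<pi> k h)" for k l
  define r where "r k = row_marg I2 \<pi> k" for k
  define c where "c = p_LC_plus I1 I2 \<pi> (Suc j)"
  have rp: "r k > 0" if "k \<in> {1..I1}" for k
    unfolding r_def row_marg_def using that pos Suc.prems by (intro sum_pos) auto
  have tp: "t k (Suc j) > 0" if "k \<in> {1..I1}" for k
    unfolding t_def using that pos Suc.prems by (intro sum_pos) auto
  have qp: "\<pi> k (Suc j) > 0" if "k \<in> {1..I1}" for k
    using that pos Suc.prems by auto
  have c0: "c 0 > 0" and c1: "c 1 > 0"
    unfolding c_def p_LC_plus_def p_LC_def using i qp tp
    by (auto intro!: sum_pos simp flip: t_def)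
  have ii: "i \<in> {1..I1}" "Suc i \<in> {1..I1}"
    using i by auto
  have split: "t k j / r k = \<pi> k (Suc j) / r k + t k (Suc j) / r k" for k
    unfolding t_def using Suc.prems by (subst sum_greaterThan_head) (auto simp: add_divide_distrib)
  \<comment> \<open>The divisor \<open>d\<close> will be \<open>c 0\<close> or \<open>c 1\<close>, a
    total common to both rows, so only the conditional probabilities matter.\<close>
  have F_less: "F (x / (r k * d)) < F (y / (r l * d))"
    if "x / r k < y / r l" "0 < x" "0 < y" "0 < d" "k \<in> {1..I1}" "l \<in> {1..I1}" for x y d k l
  proof (rule strict_mono_onD[OF strict])
    show "x / (r k * d) < y / (r l * d)"
      using divide_strict_right_mono[OF that(1,4)] by simp
  qed (use that rp in auto)
  have "t i (Suc j) / r i \<le> t (Suc i) (Suc j) / r (Suc i)"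
  proof (rule ccontr)
    assume "\<not> ?thesis"
    then have less: "t (Suc i) (Suc j) / r (Suc i) < t i (Suc j) / r i"
      by simp
    moreover have "t i j / r i \<le> t (Suc i) j / r (Suc i)"
      using Suc unfolding t_def r_def by simp
    ultimately have "\<pi> i (Suc j) / r i < \<pi> (Suc i) (Suc j) / r (Suc i)"
      unfolding split by linarith
    \<comment> \<open>From row \<open>i\<close> to \<open>Suc i\<close>, the interaction is the
      change in \<open>F\<close> at the tail, here negative, minus the change in \<open>F\<close> at
      the cell, here positive.\<close>
    from F_less[OF this qp qp c0] F_less[OF less tp tp c1] ii
    have "gamma_LC F I1 I2 \<pi> i (Suc j) < 0"
      unfolding gamma_LC_def by (simp add: p_LC_def flip: t_def r_def c_def)
    with gamma[of "Suc j"] Suc.prems show False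
      by simp
  qed
  then show ?case
    unfolding t_def r_def .
qed

theorem proposition6:
  fixes \<phi> F :: "real \<Rightarrow> real" and \<pi> :: "nat \<Rightarrow> nat \<Rightarrow> real" and I1 I2 :: nat
  assumes convex: "convex_on {0..} \<phi>"
    and deriv: "\<And>x. x > 0 \<Longrightarrow> (\<phi> has_real_derivative F x) (at x)"
    and norm: "\<phi> 1 = 0" "F 1 = 0"
    and strict: "strict_mono_on {0<..} F"
    and dims: "I1 \<ge> 2" "I2 \<ge> 2"
    and pos: "\<And>i j. i \<in> {1..I1} \<Longrightarrow> j \<in> {1..I2} \<Longrightarrow> \<pi> i j > 0"
    and total: "(\<Sum>i\<in>{1..I1}. \<Sum>j\<in>{1..I2}. \<pi> i j) = 1"
    and gamma: "\<And>i j. i \<in> {1..<I1} \<Longrightarrow> j \<in> {1..<I2} \<Longrightarrow> gamma_LC F I1 I2 \<pi> i j \<ge> 0"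
  shows "(\<forall>i\<in>{1..<I1}. \<forall>j\<in>{1..<I2}. eta_LG I2 \<pi> i j \<ge> 0) \<and>
         (\<forall>i\<in>{1..<I1}. \<forall>j\<in>{1..<I2}. eta_GG I1 I2 \<pi> i j \<ge> 0)"
proof -
  define t where "t i j = (\<Sum>h\<in>{j<..I2}. \<pi> i h)" for i j
  define u where "u i j = (\<Sum>h\<in>{1..j}. \<pi> i h)" for i j
  have tp: "t i j > 0" if "i \<in> {1..I1}" "j \<in> {1..<I2}" for i j
    unfolding t_def using that pos by (intro sum_pos) auto
  have up: "u i j > 0" if "i \<in> {1..I1}" "j \<in> {1..<I2}" for i j
    unfolding u_def using that pos by (intro sum_pos) auto
  have marg: "row_marg I2 \<pi> i = t i j + u i j" if "j \<in> {1..<I2}" for i j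
    using sum_atMost_plus_greaterThan[of j I2 "\<pi> i"] that
    unfolding row_marg_def t_def u_def by simp
  \<comment> \<open>The rows need not be adjacent, since \<open>eta_GG\<close> pairs every row up to
    \<open>i\<close> with every row beyond it.\<close>
  have odds: "t g j * u g' j \<le> t g' j * u g j"
    if g: "1 \<le> g" "g \<le> g'" "g' \<le> I1" and j: "j \<in> {1..<I2}" for g g' j
  proof -
    \<comment> \<open>Adjacent rows are chained through the quotients, where transitivity is
      immediate.\<close>
    have "g' \<le> I1 \<Longrightarrow> t g j / row_marg I2 \<pi> g \<le> t g' j / row_marg I2 \<pi> g'"
      using \<open>g \<le> g'\<close>
    proof (induction rule: dec_induct)
      case base
      show ?case by simp
    next
      case (step k)
      have "t k j / row_marg I2 \<pi> k \<le> t (Suc k) j / row_marg I2 \<pi> (Suc k)"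
        unfolding t_def using step g j gamma
        by (intro conditional_tail_mono_step[where ?I1.0 = I1, OF strict pos]) auto
      then show ?case
        using step by simp
    qed
    then show ?thesis
      using g j tp[of g j] up[of g j] tp[of g' j] up[of g' j]
      by (simp add: marg[OF j] odds_le_iff)
  qed
  have "eta_LG I2 \<pi> i j \<ge> 0" if "i \<in> {1..<I1}" "j \<in> {1..<I2}" for i j
    unfolding eta_LG_def t_def[symmetric] u_def[symmetric]
    using that odds[of i "i + 1" j] tp[of i j] up[of "i + 1" j]
    by (intro ln_divide_nonneg) auto
  moreover have "eta_GG I1 I2 \<pi> i j \<ge> 0" if "i \<in> {1..<I1}" "j \<in> {1..<I2}" for i j
    unfolding eta_GG_def t_def[symmetric] u_def[symmetric]
  proof (rule ln_divide_nonneg)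
    show "0 < (\<Sum>g\<in>{1..i}. t g j) * (\<Sum>g\<in>{i<..I1}. u g j)"
      using that tp up by (intro mult_pos_pos sum_pos) auto
    have "(\<Sum>g\<in>{1..i}. t g j) * (\<Sum>g\<in>{i<..I1}. u g j)
        = (\<Sum>g\<in>{1..i}. \<Sum>g'\<in>{i<..I1}. t g j * u g' j)"
      by (simp add: sum_product)
    \<comment> \<open>Each pair has \<open>g \<le> i < g'\<close>, so the inequality holds term by
      term.\<close>
    also have "\<dots> \<le> (\<Sum>g\<in>{1..i}. \<Sum>g'\<in>{i<..I1}. t g' j * u g j)"
      using that by (intro sum_mono odds) auto
    also have "\<dots> = (\<Sum>g\<in>{i<..I1}. t g j) * (\<Sum>g\<in>{1..i}. u g j)"
      by (subst sum.swap) (simp add: sum_product)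
    finally show "(\<Sum>g\<in>{1..i}. t g j) * (\<Sum>g\<in>{i<..I1}. u g j)
        \<le> (\<Sum>g\<in>{i<..I1}. t g j) * (\<Sum>g\<in>{1..i}. u g j)" .
  qed
  ultimately show ?thesis
    by blast
qed

end
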